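(* Let $\mathbb{B}_0=(X_1,X_2,X_3)$ be the basis of $\mathrm{sl}(2,\mathbb{R})$ with $[X_1,X_2]=2X_3$, $[X_3,X_1]=2X_2$, $[X_3,X_2]=2X_1$. Let $a\ne0$, $\alpha<0$, $\beta>0$ be real and consider the left invariant metric on $\widetilde{\mathrm{PSL}}(2,\mathbb{R})$ with matrix in $\mathbb{B}_0$ $$\frac{4}{a^2\alpha\sqrt{\alpha^2+\beta^2}}\begin{pmatrix}-\sqrt{\alpha^2+\beta^2}&0&\beta\\0&\frac{a^2\alpha}{\sqrt{\alpha^2+\beta^2}}&0\\ \beta&0&\frac{\alpha^2-\beta^2}{\sqrt{\alpha^2+\beta^2}}\end{pmatrix}.$$ Its Ricci curvature and scalar curvature are $$M(\mathrm{ric},\mathbb{B}_0)=\begin{pmatrix}\frac{2(2\alpha-a^2)}{\alpha}&0&\frac{2(a^4-4\alpha^2)\beta}{a^2\alpha\sqrt{\alpha^2+\beta^2}}\\0&-\frac{2(a^4+4\beta^2)}{\alpha^2+\beta^2}&0\\ \frac{2(a^4-4\alpha^2)\beta}{a^2\alpha\sqrt{\alpha^2+\beta^2}}&0&-\frac{2(a^2-2\alpha)(a^2(\beta^2-\alpha^2)+4\alpha\beta^2)}{a^2\alpha(\alpha^2+\beta^2)}\end{pmatrix},\qquad \mathfrak{s}=\frac12a^4-2a^2\alpha-2\beta^2.$$ The signature of $\mathrm{ric}$ is $(+,-,-)$, and the Ricci operator is of type $\{az\bar z\}$.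
   Context: $\widetilde{\mathrm{PSL}}(2,\mathbb{R})$ is the universal covering group of $\mathrm{SL}(2,\mathbb{R})$. A left invariant metric on a Lie group with Lie algebra $\mathfrak{g}$ is identified with a nondegenerate symmetric bilinear form $\langle\,,\rangle$ on $\mathfrak{g}$. The Levi-Civita product $\mathrm{L}:\mathfrak{g}\times\mathfrak{g}\to\mathfrak{g}$ is given by $2\langle\mathrm{L}_uv,w\rangle=\langle[u,v],w\rangle+\langle[w,u],v\rangle+\langle[w,v],u\rangle$, the curvature by $\mathrm{K}(u,v)=\mathrm{L}_{[u,v]}-[\mathrm{L}_u,\mathrm{L}_v]$, the Ricci tensor by $\mathrm{ric}(u,v)=\mathrm{tr}(w\mapsto\mathrm{K}(u,w)v)$, the Ricci operator by $\langle\mathrm{Ric}(u),v\rangle=\mathrm{ric}(u,v)$, and the scalar curvature by $\mathfrak{s}=\mathrm{tr}(\mathrm{Ric})$. $M(\mathrm{ric},\mathbb{B}_0)$ is the Gram matrix of $\mathrm{ric}$ in $\mathbb{B}_0$. The signature of $\mathrm{ric}$ is its signature as a symmetric bilinear form (signs listed in any order). A symmetric endomorphism of a three dimensional Lorentzian vector space is of type $\{az\bar z\}$ if it has one real eigenvalue and two non-real complex conjugate eigenvalues. *)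

theory Defs
  imports "HOL-Analysis.Analysis"
begin

subsection \<open>Finite-dimensional linear algebra\<close>

definition vs_basis :: "'g::real_vector set \<Rightarrow> bool" where
  "vs_basis B \<longleftrightarrow> finite B \<and> independent B \<and> span B = UNIV"

text \<open>The library's \<open>trace\<close> is for square matrices only. The trace of an
  endomorphism is computed in some finite basis; by \<open>endo_trace_eq\<close> below the choice is
  irrelevant for linear maps.\<close>
definition endo_trace :: "('g::real_vector \<Rightarrow> 'g) \<Rightarrow> real" where
  "endo_trace f = (let B = (SOME B. vs_basis B) in \<Sum>b\<in>B. representation B (f b) b)"

lemma endo_trace_basis_change:
  fixes f :: "'g::real_vector \<Rightarrow> 'g"
  assumes f: "linear f" and B: "vs_basis B" and C: "vs_basis C"
  shows "(\<Sum>b\<in>B. representation B (f b) b) = (\<Sum>c\<in>C. representation C (f c) c)"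
proof -
  have lin: "representation D (\<Sum>x\<in>E. k x *\<^sub>R g x) d = (\<Sum>x\<in>E. k x * representation D (g x) d)"
    if "vs_basis D" for D :: "'g set" and E :: "'g set" and k g d
    using that unfolding vs_basis_def
    by (simp add: real_vector.representation_sum real_vector.representation_scale)
  have expand: "(\<Sum>d\<in>D. representation D v d *\<^sub>R d) = v" if "vs_basis D" for D :: "'g set" and v
    using that unfolding vs_basis_def
    by (intro real_vector.sum_representation_eq) auto
  have "(\<Sum>b\<in>B. representation B (f b) b)
      = (\<Sum>b\<in>B. \<Sum>c\<in>C. representation C b c * representation B (f c) b)"
  proof (rule sum.cong[OF refl])
    fix b
    have "f b = f (\<Sum>c\<in>C. representation C b c *\<^sub>R c)"
      by (simp only: expand[OF C])
    then have "f b = (\<Sum>c\<in>C. representation C b c *\<^sub>R f c)"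
      by (simp only: linear_sum[OF f] linear_scale[OF f])
    then show "representation B (f b) b = (\<Sum>c\<in>C. representation C b c * representation B (f c) b)"
      by (simp only: lin[OF B])
  qed
  also have "\<dots> = (\<Sum>c\<in>C. \<Sum>b\<in>B. representation B (f c) b * representation C b c)"
    by (subst sum.swap) (simp add: mult.commute)
  also have "\<dots> = (\<Sum>c\<in>C. representation C (f c) c)"
  proof (rule sum.cong[OF refl])
    fix c
    show "(\<Sum>b\<in>B. representation B (f c) b * representation C b c) = representation C (f c) c"
      by (simp only: lin[OF C, where g = "\<lambda>b. b", symmetric] expand[OF B])
  qed
  finally show ?thesis .
qed

lemma endo_trace_eq:
  assumes "linear f" "vs_basis B"
  shows "endo_trace f = (\<Sum>b\<in>B. representation B (f b) b)"
  unfolding endo_trace_def Let_def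
  by (rule endo_trace_basis_change[OF assms(1) _ assms(2)], rule someI[of vs_basis, OF assms(2)])

text \<open>The eigenvalues in \<open>\<complex>\<close> of a real endomorphism \<open>f\<close>: a nonzero vector
  \<open>u + \<i> v\<close> of the complexification is sent by the complexified map to
  \<open>f u + \<i> f v\<close>; the two equations are the real and imaginary parts of
  \<open>f u + \<i> f v = z (u + \<i> v)\<close>.\<close>
definition complex_eigenvalues :: "('g::real_vector \<Rightarrow> 'g) \<Rightarrow> complex set" where
  "complex_eigenvalues f =
     {z. \<exists>u v. (u \<noteq> 0 \<or> v \<noteq> 0) \<and> f u = Re z *\<^sub>R u - Im z *\<^sub>R v \<and> f v = Im z *\<^sub>R u + Re z *\<^sub>R v}"

subsection \<open>Symmetric bilinear forms\<close>

definition symmetric_form :: "('g::real_vector \<Rightarrow> 'g \<Rightarrow> real) \<Rightarrow> bool" where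
  "symmetric_form m \<longleftrightarrow> bilinear m \<and> (\<forall>u v. m u v = m v u)"

definition pseudo_metric :: "('g::real_vector \<Rightarrow> 'g \<Rightarrow> real) \<Rightarrow> bool" where
  "pseudo_metric m \<longleftrightarrow> symmetric_form m \<and> (\<forall>u. (\<forall>v. m u v = 0) \<longrightarrow> u = 0)"

text \<open>\<open>has_signature m p q r\<close>: some orthogonal basis has \<open>p\<close> vectors with
  \<open>m x x > 0\<close>, \<open>q\<close> with \<open>m x x < 0\<close> and \<open>r\<close> with \<open>m x x = 0\<close>
  (the numbers do not depend on the basis, by Sylvester's law of inertia).\<close>
definition has_signature :: "('g::real_vector \<Rightarrow> 'g \<Rightarrow> real) \<Rightarrow> nat \<Rightarrow> nat \<Rightarrow> nat \<Rightarrow> bool" where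
  "has_signature m p q r \<longleftrightarrow> symmetric_form m \<and>
     (\<exists>B. vs_basis B \<and> (\<forall>x\<in>B. \<forall>y\<in>B. x \<noteq> y \<longrightarrow> m x y = 0) \<and>
          card {x\<in>B. m x x > 0} = p \<and> card {x\<in>B. m x x < 0} = q \<and> card {x\<in>B. m x x = 0} = r)"

definition gram_matrix :: "('g \<Rightarrow> 'g \<Rightarrow> real) \<Rightarrow> ('n \<Rightarrow> 'g) \<Rightarrow> real^'n^'n" where
  "gram_matrix m X = (\<chi> i j. m (X i) (X j))"

text \<open>The type with eigenvalues \<open>a, z, cnj z\<close>, for a symmetric endomorphism of a
  three-dimensional Lorentzian space, Lorentzian meaning signature \<open>(+,+,-)\<close>.\<close>
definition type_azz :: "('g::real_vector \<Rightarrow> 'g \<Rightarrow> real) \<Rightarrow> ('g \<Rightarrow> 'g) \<Rightarrow> bool" where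
  "type_azz m f \<longleftrightarrow> has_signature m 2 1 0 \<and> linear f \<and> (\<forall>u v. m (f u) v = m u (f v)) \<and>
     (\<exists>a::real. \<exists>z::complex. z \<notin> \<real> \<and> complex_eigenvalues f = {complex_of_real a, z, cnj z})"

subsection \<open>Curvature of a left invariant metric\<close>

text \<open>A left invariant metric on a Lie group is identified with a pseudo_metric \<open>m\<close> on its Lie
  algebra; \<open>br\<close> is the Lie bracket. For a pseudo_metric on a finite-dimensional space the
  defining equation under each \<open>THE\<close> has exactly one solution. The curvature sign is
  \<open>K(u,v) = L\<^bsub>[u,v]\<^esub> - [L\<^sub>u, L\<^sub>v]\<close>.\<close>

definition levi_civita ::
  "('g::real_vector \<Rightarrow> 'g \<Rightarrow> 'g) \<Rightarrow> ('g \<Rightarrow> 'g \<Rightarrow> real) \<Rightarrow> 'g \<Rightarrow> 'g \<Rightarrow> 'g" where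
  "levi_civita br m u v =
     (THE x. \<forall>w. 2 * m x w = m (br u v) w + m (br w u) v + m (br w v) u)"

definition curvature ::
  "('g::real_vector \<Rightarrow> 'g \<Rightarrow> 'g) \<Rightarrow> ('g \<Rightarrow> 'g \<Rightarrow> real) \<Rightarrow> 'g \<Rightarrow> 'g \<Rightarrow> 'g \<Rightarrow> 'g" where
  "curvature br m u v w = levi_civita br m (br u v) w
     - (levi_civita br m u (levi_civita br m v w) - levi_civita br m v (levi_civita br m u w))"

definition ricci ::
  "('g::real_vector \<Rightarrow> 'g \<Rightarrow> 'g) \<Rightarrow> ('g \<Rightarrow> 'g \<Rightarrow> real) \<Rightarrow> 'g \<Rightarrow> 'g \<Rightarrow> real" where
  "ricci br m u v = endo_trace (\<lambda>w. curvature br m u w v)"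

definition ricci_operator ::
  "('g::real_vector \<Rightarrow> 'g \<Rightarrow> 'g) \<Rightarrow> ('g \<Rightarrow> 'g \<Rightarrow> real) \<Rightarrow> 'g \<Rightarrow> 'g" where
  "ricci_operator br m u = (THE x. \<forall>v. m x v = ricci br m u v)"

definition scalar_curvature ::
  "('g::real_vector \<Rightarrow> 'g \<Rightarrow> 'g) \<Rightarrow> ('g \<Rightarrow> 'g \<Rightarrow> real) \<Rightarrow> real" where
  "scalar_curvature br m = endo_trace (ricci_operator br m)"

subsection \<open>The Lie algebra \<open>sl(2,\<real>)\<close>\<close>

typedef sl2 = "{A :: real^2^2. trace A = 0}"
  by (rule exI[of _ 0]) (simp add: trace_def)

setup_lifting type_definition_sl2

instantiation sl2 :: real_vector
begin

lift_definition zero_sl2 :: sl2 is 0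
  by (simp add: trace_def)
lift_definition plus_sl2 :: "sl2 \<Rightarrow> sl2 \<Rightarrow> sl2" is "(+)"
  by (simp add: trace_add)
lift_definition minus_sl2 :: "sl2 \<Rightarrow> sl2 \<Rightarrow> sl2" is "(-)"
  by (simp add: trace_sub)
lift_definition uminus_sl2 :: "sl2 \<Rightarrow> sl2" is uminus
  by (simp add: trace_def sum_negf)
lift_definition scaleR_sl2 :: "real \<Rightarrow> sl2 \<Rightarrow> sl2" is scaleR
  by (simp only: mem_Collect_eq trace_def vector_scaleR_component flip: scaleR_sum_right) simp

instance
  by standard (simp_all add: Rep_sl2_inject[symmetric] zero_sl2.rep_eq plus_sl2.rep_eq
      minus_sl2.rep_eq uminus_sl2.rep_eq scaleR_sl2.rep_eq scaleR_add_left scaleR_add_right)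

end

lift_definition sl2_bracket :: "sl2 \<Rightarrow> sl2 \<Rightarrow> sl2" is "\<lambda>A B. A ** B - B ** A"
  by (simp only: mem_Collect_eq trace_sub right_minus_eq) (rule trace_mul_sym)

text \<open>One such basis is \<open>X 1 = ((0,1),(-1,0))\<close>, \<open>X 2 = ((0,1),(1,0))\<close>,
  \<open>X 3 = ((1,0),(0,-1))\<close>.\<close>
definition sl2_basis_B0 :: "(3 \<Rightarrow> sl2) \<Rightarrow> bool" where
  "sl2_basis_B0 X \<longleftrightarrow> inj X \<and> vs_basis (range X) \<and>
     sl2_bracket (X 1) (X 2) = 2 *\<^sub>R X 3 \<and>
     sl2_bracket (X 3) (X 1) = 2 *\<^sub>R X 2 \<and>
     sl2_bracket (X 3) (X 2) = 2 *\<^sub>R X 1"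

end

(* The matrices of the metric, of the Ricci tensor and of the Ricci operator have a block shape:
   X 2 is orthogonal to the span of X 1 and X 3. The Koszul formula gives the Levi-Civita product
   in coordinates, hence Ric. On the X 1 - X 3 block Ric has trace K a^2 and determinant
   K^2 (a^4/4 + beta^2) with K = a^2 - 2 alpha > 0, hence the eigenvalues K (a^2/2 \<plusminus> i beta).
   The block of ric has determinant det(metric block) det(Ric block) < 0. *)
theory Submission
  imports Defs
begin

section \<open>The matrix commutator, and uniqueness from nondegeneracy\<close>

lemma Rep_sl2_bracket_component:
  "Rep_sl2 (sl2_bracket A B) $ i $ j =
    (\<Sum>h\<in>UNIV. Rep_sl2 A $ i $ h * Rep_sl2 B $ h $ j) - (\<Sum>h\<in>UNIV. Rep_sl2 B $ i $ h * Rep_sl2 A $ h $ j)"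
  by (simp add: sl2_bracket.rep_eq matrix_matrix_mult_def)

lemma sl2_eqI: "(\<And>i j. Rep_sl2 A $ i $ j = Rep_sl2 B $ i $ j) \<Longrightarrow> A = B"
  by (simp add: vec_eq_iff flip: Rep_sl2_inject)

text \<open>Each entry of a commutator is a sum of products of one entry from either factor.\<close>

lemma bilinear_sl2_bracket: "bilinear sl2_bracket"
  unfolding bilinear_def
  by (intro conjI allI linearI sl2_eqI)
    (simp_all add: Rep_sl2_bracket_component plus_sl2.rep_eq scaleR_sl2.rep_eq sum_2 algebra_simps)

lemma sl2_bracket_swap: "sl2_bracket B A = - sl2_bracket A B"
  by (simp add: Rep_sl2_inject[symmetric] sl2_bracket.rep_eq uminus_sl2.rep_eq)

text \<open>Nondegeneracy applied to \<open>x - y\<close>. This gives the uniqueness behind both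
  definite descriptions evaluated below.\<close>

lemma pseudo_metric_eqI:
  assumes "pseudo_metric m" and "\<And>w. m x w = m y w"
  shows "x = y"
proof -
  have "bilinear m"
    using assms(1) by (simp add: pseudo_metric_def symmetric_form_def)
  then have "m (x - y) w = 0" for w
    by (simp add: bilinear_lsub assms(2))
  then show ?thesis
    using assms(1) unfolding pseudo_metric_def by (metis eq_iff_diff_eq_0)
qed

text \<open>The Koszul formula fixes all pairings of its solution, so exhibiting one solution
  evaluates the \<open>THE\<close>.\<close>

lemma levi_civita_eqI:
  assumes "pseudo_metric m"
    and x: "\<And>w. 2 * m x w = m (br u v) w + m (br w u) v + m (br w v) u"
  shows "levi_civita br m u v = x"
  unfolding levi_civita_def
proof (rule the_equality)
  fix y assume y: "\<forall>w. 2 * m y w = m (br u v) w + m (br w u) v + m (br w v) u"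
  show "y = x"
  proof (rule pseudo_metric_eqI[OF assms(1)])
    fix w
    have "2 * m y w = 2 * m x w"
      unfolding x using y by blast
    then show "m y w = m x w" by simp
  qed
qed (use x in blast)

lemma ricci_operator_eqI:
  assumes "pseudo_metric m" and "\<And>v. m x v = ricci br m u v"
  shows "ricci_operator br m u = x"
  unfolding ricci_operator_def
proof (rule the_equality)
  fix y assume "\<forall>v. m y v = ricci br m u v"
  then show "y = x"
    using assms by (intro pseudo_metric_eqI[OF assms(1)]) simp
qed (use assms in blast)

section \<open>Coordinates in a frame of three vectors\<close>

locale frame3 =
  fixes X :: "3 \<Rightarrow> 'g::real_vector"
  assumes inj_X: "inj X" and basis_X: "vs_basis (range X)"
begin

text \<open>Three separate real coordinates, rather than a function on indices, let identities
  between vectors reduce to polynomial identities by simplification.\<close>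

definition lincomb :: "real \<Rightarrow> real \<Rightarrow> real \<Rightarrow> 'g" where
  "lincomb x y z = x *\<^sub>R X 1 + y *\<^sub>R X 2 + z *\<^sub>R X 3"

lemma range_X: "range X = {X 1, X 2, X 3}"
  by (auto simp: UNIV_3)

lemma X_neq: "X 1 \<noteq> X 2" "X 1 \<noteq> X 3" "X 2 \<noteq> X 3"
  using inj_X by (simp_all add: inj_eq)

lemma X_lincomb: "X 1 = lincomb 1 0 0" "X 2 = lincomb 0 1 0" "X 3 = lincomb 0 0 1"
  by (simp_all add: lincomb_def)

lemma lincomb_add: "lincomb x y z + lincomb x' y' z' = lincomb (x + x') (y + y') (z + z')"
  and lincomb_diff: "lincomb x y z - lincomb x' y' z' = lincomb (x - x') (y - y') (z - z')"
  and lincomb_scaleR: "r *\<^sub>R lincomb x y z = lincomb (r * x) (r * y) (r * z)"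
  and lincomb_minus: "- lincomb x y z = lincomb (- x) (- y) (- z)"
  by (simp_all add: lincomb_def algebra_simps)

lemmas lincomb_arith = lincomb_add lincomb_diff lincomb_scaleR lincomb_minus

lemma lincomb_eq_0_iff: "lincomb x y z = 0 \<longleftrightarrow> x = 0 \<and> y = 0 \<and> z = 0"
proof
  assume eq: "lincomb x y z = 0"
  \<comment> \<open>Independence concerns coefficients attached to vectors. Since the
    \<open>X i\<close> are distinct, \<open>c\<close> carries the three indexed coefficients over to
    vectors.\<close>
  define c where "c v = (if v = X 1 then x else if v = X 2 then y else z)" for v
  have "(\<Sum>v\<in>range X. c v *\<^sub>R v) = 0"
    using eq X_neq by (simp add: range_X c_def lincomb_def add.assoc)
  moreover have "independent (range X)" "finite (range X)"
    using basis_X by (auto simp: vs_basis_def)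
  ultimately have "\<forall>v\<in>range X. c v = 0"
    using independentD[of "range X" "range X" c] by blast
  then show "x = 0 \<and> y = 0 \<and> z = 0"
    using X_neq by (auto simp: range_X c_def split: if_splits)
qed (simp add: lincomb_def)

lemma lincomb_inject [simp]:
  "lincomb x y z = lincomb x' y' z' \<longleftrightarrow> x = x' \<and> y = y' \<and> z = z'"
  using lincomb_eq_0_iff[of "x - x'" "y - y'" "z - z'"]
  by (simp flip: lincomb_diff)

lemma lincomb_cases:
  obtains x y z where "v = lincomb x y z"
proof -
  have "v \<in> span {X 1, X 2, X 3}"
    using basis_X by (simp add: vs_basis_def range_X)
  then obtain k where "v - k *\<^sub>R X 1 \<in> span {X 2, X 3}"
    by (auto simp: span_breakdown_eq)
  then obtain k' k'' where "v - k *\<^sub>R X 1 - k' *\<^sub>R X 2 - k'' *\<^sub>R X 3 = 0"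
    by (auto simp: span_breakdown_eq)
  then have "v = lincomb k k' k''"
    by (simp add: lincomb_def algebra_simps)
  then show ?thesis ..
qed

lemma representation_lincomb:
  "representation (range X) (lincomb x y z) (X 1) = x"
  "representation (range X) (lincomb x y z) (X 2) = y"
  "representation (range X) (lincomb x y z) (X 3) = z"
proof -
  have ind: "independent (range X)" and mem: "X i \<in> span (range X)" for i
    using basis_X by (auto simp: vs_basis_def intro: span_base)
  show "representation (range X) (lincomb x y z) (X 1) = x"
    "representation (range X) (lincomb x y z) (X 2) = y"
    "representation (range X) (lincomb x y z) (X 3) = z"
    using X_neq unfolding lincomb_def
    by (simp_all add: representation_add[OF ind] representation_scale[OF ind] span_scale span_add
        mem representation_basis[OF ind])
qed

text \<open>By basis independence the trace may be taken in the frame itself, where it is the sum of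
  the diagonal coordinates.\<close>

lemma endo_trace_lincomb:
  assumes "linear f"
    and "f (X 1) = lincomb x1 y1 z1" "f (X 2) = lincomb x2 y2 z2" "f (X 3) = lincomb x3 y3 z3"
  shows "endo_trace f = x1 + y2 + z3"
proof -
  have "endo_trace f = (\<Sum>b\<in>{X 1, X 2, X 3}. representation (range X) (f b) b)"
    using endo_trace_eq[OF assms(1) basis_X] by (simp add: range_X)
  then show ?thesis
    using X_neq by (simp add: assms representation_lincomb)
qed

text \<open>Reads linearity off a coordinate formula; \<open>f1\<close>, \<open>f2\<close>,
  \<open>f3\<close> are the images of the frame vectors.\<close>

lemma linear_lincombI:
  fixes f :: "'g \<Rightarrow> 'h::real_vector"
  assumes "\<And>x y z. f (lincomb x y z) = x *\<^sub>R f1 + y *\<^sub>R f2 + z *\<^sub>R f3"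
  shows "linear f"
proof (rule linearI)
  fix u v :: 'g and r :: real
  obtain x y z where u: "u = lincomb x y z" by (rule lincomb_cases)
  obtain x' y' z' where v: "v = lincomb x' y' z'" by (rule lincomb_cases)
  show "f (u + v) = f u + f v"
    by (simp add: u v assms lincomb_arith algebra_simps)
  show "f (r *\<^sub>R u) = r *\<^sub>R f u"
    by (simp add: u assms lincomb_arith algebra_simps)
qed

lemma bilinear_lincombI:
  fixes f :: "'g \<Rightarrow> 'g \<Rightarrow> 'h::real_vector"
  assumes "\<And>x y z x' y' z'. f (lincomb x y z) (lincomb x' y' z') =
    (x * x') *\<^sub>R f11 + (x * y') *\<^sub>R f12 + (x * z') *\<^sub>R f13 +
    (y * x') *\<^sub>R f21 + (y * y') *\<^sub>R f22 + (y * z') *\<^sub>R f23 +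
    (z * x') *\<^sub>R f31 + (z * y') *\<^sub>R f32 + (z * z') *\<^sub>R f33"
  shows "bilinear f"
  unfolding bilinear_def
proof (intro conjI allI)
  fix u
  obtain x y z where u: "u = lincomb x y z" by (rule lincomb_cases)
  show "linear (f u)"
    by (rule linear_lincombI[where ?f1.0 = "x *\<^sub>R f11 + y *\<^sub>R f21 + z *\<^sub>R f31"
          and ?f2.0 = "x *\<^sub>R f12 + y *\<^sub>R f22 + z *\<^sub>R f32"
          and ?f3.0 = "x *\<^sub>R f13 + y *\<^sub>R f23 + z *\<^sub>R f33"])
      (simp add: u assms algebra_simps)
  show "linear (\<lambda>v. f v u)"
    by (rule linear_lincombI[where ?f1.0 = "x *\<^sub>R f11 + y *\<^sub>R f12 + z *\<^sub>R f13"
          and ?f2.0 = "x *\<^sub>R f21 + y *\<^sub>R f22 + z *\<^sub>R f23"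
          and ?f3.0 = "x *\<^sub>R f31 + y *\<^sub>R f32 + z *\<^sub>R f33"])
      (simp add: u assms algebra_simps)
qed

lemma bilinear_lincomb:
  assumes "bilinear f"
  shows "f (lincomb x y z) (lincomb x' y' z') =
    (x * x') *\<^sub>R f (X 1) (X 1) + (x * y') *\<^sub>R f (X 1) (X 2) + (x * z') *\<^sub>R f (X 1) (X 3) +
    (y * x') *\<^sub>R f (X 2) (X 1) + (y * y') *\<^sub>R f (X 2) (X 2) + (y * z') *\<^sub>R f (X 2) (X 3) +
    (z * x') *\<^sub>R f (X 3) (X 1) + (z * y') *\<^sub>R f (X 3) (X 2) + (z * z') *\<^sub>R f (X 3) (X 3)"
  by (simp add: lincomb_def bilinear_ladd[OF assms] bilinear_radd[OF assms]
      bilinear_lmul[OF assms] bilinear_rmul[OF assms] algebra_simps)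

section \<open>Signature and complex spectrum in block form\<close>

text \<open>The \<open>X 1\<close>-\<open>X 3\<close> block is diagonalized by replacing \<open>X 3\<close> with
  \<open>X 3 - (q / p) X 1\<close>, on which the form takes the value \<open>(p r - q\<^sup>2) / p\<close>.\<close>
lemma has_signature_block:
  assumes g: "\<And>x y z x' y' z'. g (lincomb x y z) (lincomb x' y' z') =
      p * (x * x') + q * (x * z' + z * x') + r * (z * z') + t * (y * y')"
    and "p > 0" and "p * r - q\<^sup>2 < 0"
  shows "t > 0 \<Longrightarrow> has_signature g 2 1 0" and "t < 0 \<Longrightarrow> has_signature g 1 2 0"
proof -
  define b1 b2 b3 where b: "b1 = lincomb 1 0 0" "b2 = lincomb 0 1 0" "b3 = lincomb (- q / p) 0 1"
  let ?B = "{b1, b2, b3}"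
  have "bilinear g"
    by (rule bilinear_lincombI[where ?f11.0 = p and ?f12.0 = 0 and ?f13.0 = q and ?f21.0 = 0
          and ?f22.0 = t and ?f23.0 = 0 and ?f31.0 = q and ?f32.0 = 0 and ?f33.0 = r])
      (simp add: g algebra_simps)
  moreover have "g u v = g v u" for u v
    by (rule lincomb_cases[of u], rule lincomb_cases[of v]) (simp add: g algebra_simps)
  ultimately have sym: "symmetric_form g"
    by (simp add: symmetric_form_def)
  have "span (range X) \<subseteq> span ?B"
  proof (rule span_minimal)
    have "X 1 = b1" "X 2 = b2" "X 3 = b3 + (q / p) *\<^sub>R b1"
      by (simp_all add: X_lincomb lincomb_arith b)
    moreover have "b3 + (q / p) *\<^sub>R b1 \<in> span ?B" "b1 \<in> span ?B" "b2 \<in> span ?B"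
      by (simp_all add: span_base span_add span_scale)
    ultimately show "range X \<subseteq> span ?B"
      unfolding range_X by (metis empty_subsetI insert_subset)
  qed simp
  then have "span ?B = UNIV"
    using basis_X by (auto simp: vs_basis_def)
  moreover have "independent ?B"
    by (rule independent_if_scalars_zero)
      (auto simp: b lincomb_arith lincomb_eq_0_iff)
  ultimately have basis: "vs_basis ?B"
    by (simp add: vs_basis_def)
  have neq: "b1 \<noteq> b2" "b1 \<noteq> b3" "b2 \<noteq> b3"
    by (simp_all add: b)
  have val: "g b1 b1 = p" "g b2 b2 = t" "g b3 b3 = (p * r - q\<^sup>2) / p"
    using \<open>p > 0\<close> by (simp_all add: b g field_simps power2_eq_square)
  have neg: "g b3 b3 < 0"
    unfolding val using assms(2,3) by (simp add: divide_neg_pos)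
  have orth: "\<forall>x\<in>?B. \<forall>y\<in>?B. x \<noteq> y \<longrightarrow> g x y = 0"
    using \<open>p > 0\<close> by (simp add: b g)
  \<comment> \<open>The signs on \<open>b1\<close> and \<open>b3\<close> are fixed, and that on
    \<open>b2\<close> is the sign of \<open>t\<close>. Conditional singletons let one description of
    the three sets serve both cases.\<close>
  have sets: "{x\<in>?B. g x x > 0} = {b1} \<union> {x\<in>{b2}. t > 0}"
    "{x\<in>?B. g x x < 0} = {b3} \<union> {x\<in>{b2}. t < 0}"
    "{x\<in>?B. g x x = 0} = {x\<in>{b2}. t = 0}"
    using val(1,2) neg \<open>p > 0\<close> by auto
  show "has_signature g 2 1 0" if "t > 0"
    unfolding has_signature_def using sym basis orth neq that
    by (intro conjI exI[of _ ?B]) (simp_all only: sets, auto)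
  show "has_signature g 1 2 0" if "t < 0"
    unfolding has_signature_def using sym basis orth neq that
    by (intro conjI exI[of _ ?B]) (simp_all only: sets, auto)
qed

text \<open>The coordinates of \<open>u + \<i> v\<close> are collected into the complex numbers
  \<open>\<xi>\<close>, \<open>\<eta>\<close>, \<open>\<zeta>\<close>.\<close>
lemma complex_eigenvalues_block:
  assumes f: "\<And>x y z. f (lincomb x y z) = lincomb (A * x + B * z) (N * y) (C * x + E * z)"
    and "B \<noteq> 0" and w: "of_real (A + E) = w + cnj w" "of_real (A * E - B * C) = w * cnj w"
  shows "complex_eigenvalues f = {of_real N, w, cnj w}"
proof -
  have "c \<in> complex_eigenvalues f \<longleftrightarrow> (\<exists>\<xi> \<eta> \<zeta>. (\<xi> \<noteq> 0 \<or> \<eta> \<noteq> 0 \<or> \<zeta> \<noteq> 0) \<and>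
      of_real A * \<xi> + of_real B * \<zeta> = c * \<xi> \<and> of_real N * \<eta> = c * \<eta> \<and>
      of_real C * \<xi> + of_real E * \<zeta> = c * \<zeta>)" (is "?L \<longleftrightarrow> ?R") for c
  proof
    assume ?L
    then obtain u v where uv: "u \<noteq> 0 \<or> v \<noteq> 0"
      "f u = Re c *\<^sub>R u - Im c *\<^sub>R v" "f v = Im c *\<^sub>R u + Re c *\<^sub>R v"
      by (auto simp: complex_eigenvalues_def)
    obtain x y z where u: "u = lincomb x y z" by (rule lincomb_cases)
    obtain x' y' z' where v: "v = lincomb x' y' z'" by (rule lincomb_cases)
    show ?R
      using uv unfolding u v
      by - (rule exI[of _ "Complex x x'"], rule exI[of _ "Complex y y'"],
          rule exI[of _ "Complex z z'"], auto simp: f lincomb_arith lincomb_eq_0_iff complex_eq_iff)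
  next
    assume ?R
    then obtain \<xi> \<eta> \<zeta> where h: "\<xi> \<noteq> 0 \<or> \<eta> \<noteq> 0 \<or> \<zeta> \<noteq> 0"
      "of_real A * \<xi> + of_real B * \<zeta> = c * \<xi>" "of_real N * \<eta> = c * \<eta>"
      "of_real C * \<xi> + of_real E * \<zeta> = c * \<zeta>" by auto
    then show ?L
      unfolding complex_eigenvalues_def
      by - (rule CollectI, rule exI[of _ "lincomb (Re \<xi>) (Re \<eta>) (Re \<zeta>)"],
          rule exI[of _ "lincomb (Im \<xi>) (Im \<eta>) (Im \<zeta>)"], auto simp: f lincomb_arith lincomb_eq_0_iff complex_eq_iff)
  qed
  moreover have "(\<exists>\<xi> \<eta> \<zeta>. (\<xi> \<noteq> 0 \<or> \<eta> \<noteq> 0 \<or> \<zeta> \<noteq> 0) \<and>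
      of_real A * \<xi> + of_real B * \<zeta> = c * \<xi> \<and> of_real N * \<eta> = c * \<eta> \<and>
      of_real C * \<xi> + of_real E * \<zeta> = c * \<zeta>) \<longleftrightarrow> c \<in> {of_real N, w, cnj w}" (is "?R \<longleftrightarrow> _") for c
  proof
    \<comment> \<open>The hypotheses \<open>w\<close> give \<open>w\<close> and \<open>cnj w\<close>
      the trace as sum and the determinant as product, so they are the roots of the characteristic
      polynomial of the block.\<close>
    have char: "(c - of_real A) * (c - of_real E) - of_real B * of_real C = (c - w) * (c - cnj w)"
      using w unfolding of_real_add of_real_diff of_real_mult by algebra
    {
      assume ?R
      then obtain \<xi> \<eta> \<zeta> where h: "\<xi> \<noteq> 0 \<or> \<eta> \<noteq> 0 \<or> \<zeta> \<noteq> 0"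
        "of_real A * \<xi> + of_real B * \<zeta> = c * \<xi>" "of_real N * \<eta> = c * \<eta>"
        "of_real C * \<xi> + of_real E * \<zeta> = c * \<zeta>" by auto
      \<comment> \<open>The coefficients on the right are the entries of the adjugate of
        \<open>c\<close> minus the block. If \<open>c\<close> is not a root, \<xi> and \<zeta>
        vanish, so \<eta> is nonzero and \<open>c\<close> equals \<open>N\<close>.\<close>
      have "(c - w) * (c - cnj w) * \<xi> =
          (c - of_real E) * (c * \<xi> - (of_real A * \<xi> + of_real B * \<zeta>)) +
          of_real B * (c * \<zeta> - (of_real C * \<xi> + of_real E * \<zeta>))"
        "(c - w) * (c - cnj w) * \<zeta> =
          of_real C * (c * \<xi> - (of_real A * \<xi> + of_real B * \<zeta>)) +
          (c - of_real A) * (c * \<zeta> - (of_real C * \<xi> + of_real E * \<zeta>))"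
        unfolding char[symmetric] by (simp_all add: algebra_simps)
      then have "(c - w) * (c - cnj w) * \<xi> = 0" "(c - w) * (c - cnj w) * \<zeta> = 0"
        using h(2,4) by simp_all
      then show "c \<in> {of_real N, w, cnj w}"
        using h(1,3) by auto }
    assume c: "c \<in> {of_real N, w, cnj w}"
    show ?R
    proof (cases "c = of_real N")
      case True
      then show ?thesis by - (rule exI[of _ 0], rule exI[of _ 1], rule exI[of _ 0], simp)
    next
      case False
      then have "(c - of_real A) * (c - of_real E) - of_real B * of_real C = 0"
        using c char by auto
      \<comment> \<open>The eigenvector has block coordinates \<open>B\<close> and
        \<open>c - A\<close>. The first row holds identically, the second is the vanishing of the
        characteristic polynomial, and \<open>B \<noteq> 0\<close> makes the vector nonzero.\<close>
      then have "of_real C * of_real B + of_real E * (c - of_real A) = c * (c - of_real A)"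
        by algebra
      moreover have "of_real A * of_real B + of_real B * (c - of_real A) = c * of_real B"
        by (simp add: algebra_simps)
      ultimately show ?thesis
        using \<open>B \<noteq> 0\<close>
        by - (rule exI[of _ "of_real B"], rule exI[of _ 0], rule exI[of _ "c - of_real A"],
          intro conjI, simp, assumption, simp, assumption)
    qed
  qed
  ultimately show ?thesis
    by (intro set_eqI) (rule trans)
qed

end

section \<open>Levi-Civita product and Ricci tensor of a block metric\<close>

text \<open>The constants \<open>k\<close>, \<open>j\<close>, \<open>b\<close>, \<open>l\<close>, \<open>n\<close> are the structure constants of the
  Levi-Civita product; the equations for them are the Koszul formula on basis vectors.\<close>
locale sl2_block_metric = frame3 X for X :: "3 \<Rightarrow> sl2" +
  fixes m :: "sl2 \<Rightarrow> sl2 \<Rightarrow> real" and p q r t k j b l n :: real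
  assumes B0: "sl2_basis_B0 X" and metric: "pseudo_metric m"
    and m_X: "m (X 1) (X 1) = p" "m (X 1) (X 2) = 0" "m (X 1) (X 3) = q"
      "m (X 2) (X 2) = t" "m (X 2) (X 3) = 0" "m (X 3) (X 3) = r"
    and koszul: "t * l = - 2 * q" "t * n = - (p + r + t)"
      "p * k + q * j = 2 * q" "q * k + r * j = p + r + t"
      "p * b - q * k = r - p - t" "q * b - r * k = 0"
begin

lemma m_lincomb:
  "m (lincomb x y z) (lincomb x' y' z') =
    p * (x * x') + q * (x * z' + z * x') + r * (z * z') + t * (y * y')"
proof -
  have "bilinear m" and sym: "m u v = m v u" for u v
    using metric by (auto simp: pseudo_metric_def symmetric_form_def)
  then show ?thesis
    using sym[of "X 2" "X 1"] sym[of "X 3" "X 1"] sym[of "X 3" "X 2"]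
    by (simp add: bilinear_lincomb m_X algebra_simps)
qed

lemma bracket_lincomb:
  "sl2_bracket (lincomb x y z) (lincomb x' y' z') =
    lincomb (2 * (z * y' - y * z')) (2 * (z * x' - x * z')) (2 * (x * y' - y * x'))"
proof -
  have self: "sl2_bracket A A = 0" for A
    using sl2_bracket_swap[of A A] by (simp add: eq_neg_iff_add_eq_0 flip: scaleR_2)
  have br: "sl2_bracket (X 1) (X 2) = 2 *\<^sub>R X 3" "sl2_bracket (X 3) (X 1) = 2 *\<^sub>R X 2"
    "sl2_bracket (X 3) (X 2) = 2 *\<^sub>R X 1"
    using B0 by (simp_all add: sl2_basis_B0_def)
  show ?thesis
    by (simp add: bilinear_lincomb[OF bilinear_sl2_bracket] self br
        sl2_bracket_swap[of "X 2" "X 1"] sl2_bracket_swap[of "X 1" "X 3"]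
        sl2_bracket_swap[of "X 2" "X 3"])
      (simp add: lincomb_def algebra_simps)
qed

text \<open>Changing the signs of \<open>X 1\<close> and \<open>X 3\<close> preserves bracket and
  metric, which forces the zero pattern of the product. The shifts by 2 express that it is torsion
  free; \<open>k\<close> recurs with opposite signs because the product by \<open>X 2\<close> is
  skew, hence of trace zero.\<close>

lemma levi_civita_lincomb:
  "levi_civita sl2_bracket m (lincomb x y z) (lincomb x' y' z') =
    lincomb (k * (x * y' + y * x') + b * (y * z') + (b + 2) * (z * y'))
      (l * (x * x' + z * z') + n * (x * z') + (n + 2) * (z * x'))
      (j * (x * y') + (j - 2) * (y * x') - k * (y * z' + z * y'))"
    (is "_ = ?L")
proof (rule levi_civita_eqI[OF metric])
  fix w
  obtain w1 w2 w3 where w: "w = lincomb w1 w2 w3" by (rule lincomb_cases)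
  \<comment> \<open>Collecting by the coordinates of \<open>w\<close> makes the left sides of
    \<open>koszul\<close> appear literally, ready to be rewritten.\<close>
  have "m ?L w = w1 * ((p * k + q * j) * (x * y') + (p * k + q * j - 2 * q) * (y * x')
        + (p * b - q * k) * (y * z') + (p * b - q * k + 2 * p) * (z * y'))
      + w2 * (t * l * (x * x' + z * z') + t * n * (x * z') + (t * n + 2 * t) * (z * x'))
      + w3 * ((q * k + r * j) * (x * y') + (q * k + r * j - 2 * r) * (y * x')
        + (q * b - r * k) * (y * z') + (q * b - r * k + 2 * q) * (z * y'))"
    by (simp add: w m_lincomb algebra_simps)
  then show "2 * m ?L w = m (sl2_bracket (lincomb x y z) (lincomb x' y' z')) w
      + m (sl2_bracket w (lincomb x y z)) (lincomb x' y' z')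
      + m (sl2_bracket w (lincomb x' y' z')) (lincomb x y z)"
    unfolding koszul by (simp add: w bracket_lincomb m_lincomb algebra_simps)
qed

text \<open>The metric enters only through the Levi-Civita product, so the trace is a polynomial in
  the structure constants.\<close>

lemma ricci_lincomb:
  "ricci sl2_bracket m (lincomb x y z) (lincomb x' y' z') =
    (4 * n + 8 - 2 * k * l - 2 * j * n - 4 * j) * (x * x')
    + (2 * k + 2 * l - b * l - j * l) * (x * z' + z * x')
    + (2 * k * l - 2 * b * n) * (z * z')
    - (2 * k\<^sup>2 + 2 * b * j + 4 * j) * (y * y')"
proof -
  note coords = curvature_def levi_civita_lincomb bracket_lincomb lincomb_arith
  let ?f = "\<lambda>w. curvature sl2_bracket m (lincomb x y z) w (lincomb x' y' z')"
  have "linear ?f"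
    by (rule linear_lincombI[where ?f1.0 = "?f (lincomb 1 0 0)" and ?f2.0 = "?f (lincomb 0 1 0)"
          and ?f3.0 = "?f (lincomb 0 0 1)"])
      (simp add: coords, simp add: algebra_simps)
  show ?thesis
    unfolding ricci_def
    \<comment> \<open>The images of the frame vectors start as unknowns; each is computed in
      coordinates and then instantiated by \<open>refl\<close>.\<close>
    by (subst endo_trace_lincomb[OF \<open>linear ?f\<close>, unfolded X_lincomb],
        (simp only: coords; rule refl)+)
      (simp add: algebra_simps power2_eq_square)
qed

context
  fixes p' q' r' t' A B C E N :: real
  assumes ric: "\<And>x y z x' y' z'. ricci sl2_bracket m (lincomb x y z) (lincomb x' y' z') =
      p' * (x * x') + q' * (x * z' + z * x') + r' * (z * z') + t' * (y * y')"
    and Ric: "p * A + q * C = p'" "q * A + r * C = q'" "p * B + q * E = q'" "q * B + r * E = r'"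
      "t * N = t'"
begin

text \<open>The equations \<open>Ric\<close> say that the Gram matrix of \<open>m\<close> times the
  block matrix with entries \<open>A\<close>, \<open>B\<close>, \<open>C\<close>, \<open>E\<close>,
  \<open>N\<close> is the Gram matrix of the Ricci tensor.\<close>

lemma metric_lincomb_eq_ricci:
  "m (lincomb (A * x + B * z) (N * y) (C * x + E * z)) v = ricci sl2_bracket m (lincomb x y z) v"
proof -
  obtain v1 v2 v3 where v: "v = lincomb v1 v2 v3" by (rule lincomb_cases)
  have "m (lincomb (A * x + B * z) (N * y) (C * x + E * z)) v =
      v1 * ((p * A + q * C) * x + (p * B + q * E) * z) + v2 * (t * N * y)
      + v3 * ((q * A + r * C) * x + (q * B + r * E) * z)"
    by (simp add: v m_lincomb algebra_simps)
  then show ?thesis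
    unfolding Ric by (simp add: v ric algebra_simps)
qed

lemma ricci_operator_lincomb:
  "ricci_operator sl2_bracket m (lincomb x y z) =
    lincomb (A * x + B * z) (N * y) (C * x + E * z)"
  by (rule ricci_operator_eqI[OF metric metric_lincomb_eq_ricci])

lemma metric_ricci_operator:
  "m (ricci_operator sl2_bracket m u) v = ricci sl2_bracket m u v"
  by (cases u rule: lincomb_cases) (simp only: ricci_operator_lincomb metric_lincomb_eq_ricci)

end

end

section \<open>The given metric: curvature, signature and spectrum\<close>

theorem proposition4p6:
  fixes X :: "3 \<Rightarrow> sl2" and m :: "sl2 \<Rightarrow> sl2 \<Rightarrow> real" and a \<alpha> \<beta> :: real
  assumes "sl2_basis_B0 X"
    and "a \<noteq> 0" and "\<alpha> < 0" and "\<beta> > 0"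
    and "pseudo_metric m"
    and "gram_matrix m X =
      (4 / (a^2 * \<alpha> * sqrt (\<alpha>^2 + \<beta>^2))) *\<^sub>R
        vector [
          vector [- sqrt (\<alpha>^2 + \<beta>^2), 0, \<beta>],
          vector [0, a^2 * \<alpha> / sqrt (\<alpha>^2 + \<beta>^2), 0],
          vector [\<beta>, 0, (\<alpha>^2 - \<beta>^2) / sqrt (\<alpha>^2 + \<beta>^2)]]"
  shows "gram_matrix (ricci sl2_bracket m) X =
      vector [
        vector [2 * (2 * \<alpha> - a^2) / \<alpha>, 0,
                2 * (a^4 - 4 * \<alpha>^2) * \<beta> / (a^2 * \<alpha> * sqrt (\<alpha>^2 + \<beta>^2))],
        vector [0, - (2 * (a^4 + 4 * \<beta>^2) / (\<alpha>^2 + \<beta>^2)), 0],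
        vector [2 * (a^4 - 4 * \<alpha>^2) * \<beta> / (a^2 * \<alpha> * sqrt (\<alpha>^2 + \<beta>^2)), 0,
                - (2 * (a^2 - 2 * \<alpha>) * (a^2 * (\<beta>^2 - \<alpha>^2) + 4 * \<alpha> * \<beta>^2)
                   / (a^2 * \<alpha> * (\<alpha>^2 + \<beta>^2)))]]
    \<and> scalar_curvature sl2_bracket m = 1/2 * a^4 - 2 * a^2 * \<alpha> - 2 * \<beta>^2
    \<and> has_signature (ricci sl2_bracket m) 1 2 0
    \<and> type_azz m (ricci_operator sl2_bracket m)"
proof -
  \<comment> \<open>Naming the root makes every quantity rational in \<open>a\<close>, \<alpha>,
    \<beta>, \<open>s\<close>, subject to the single relation \<open>s2\<close>.\<close>
  define s where "s = sqrt (\<alpha>\<^sup>2 + \<beta>\<^sup>2)"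
  have s_pos: "s > 0"
    unfolding s_def using \<open>\<alpha> < 0\<close> by (simp add: sum_power2_gt_zero_iff)
  have s2: "s\<^sup>2 = \<alpha>\<^sup>2 + \<beta>\<^sup>2"
    unfolding s_def by simp
  have nz: "a \<noteq> 0" "\<alpha> \<noteq> 0" "s \<noteq> 0"
    using assms s_pos by simp_all
  define p where "p = - 4 / (a\<^sup>2 * \<alpha>)"
  define q where "q = 4 * \<beta> / (a\<^sup>2 * \<alpha> * s)"
  define r where "r = 4 * (\<alpha>\<^sup>2 - \<beta>\<^sup>2) / (a\<^sup>2 * \<alpha> * s\<^sup>2)"
  define t where "t = 4 / s\<^sup>2"
  \<comment> \<open>These solve the Koszul equations: \<open>l\<close> and \<open>n\<close> by
    division by \<open>t\<close>, the others from two linear systems of determinant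
    \<open>p * r - q\<^sup>2\<close> up to sign, for \<open>k\<close>, \<open>j\<close> and for
    \<open>k\<close>, \<open>b\<close>, which agree on \<open>k\<close>.\<close>
  define k where "k = - \<beta> * (2 * \<alpha> - a\<^sup>2) / (s * \<alpha>)"
  define j where "j = a\<^sup>2 / \<alpha>"
  define b where "b = - (\<alpha>\<^sup>2 - \<beta>\<^sup>2) * (2 * \<alpha> - a\<^sup>2) / (s\<^sup>2 * \<alpha>)"
  define l where "l = - 2 * \<beta> * s / (a\<^sup>2 * \<alpha>)"
  define n where "n = 2 * \<beta>\<^sup>2 / (a\<^sup>2 * \<alpha>) - 1"
  note metric_defs = p_def q_def r_def t_def
  note levi_civita_defs = k_def j_def b_def l_def n_def
  interpret frame3 X
    using assms(1) by unfold_locales (simp_all add: sl2_basis_B0_def)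
  have koszul: "t * l = - 2 * q"
    "t * n = - (p + r + t)"
    "p * k + q * j = 2 * q"
    "q * k + r * j = p + r + t"
    "p * b - q * k = r - p - t"
    "q * b - r * k = 0"
  proof -
    show "t * l = - 2 * q"
      \<comment> \<open>Clearing denominators leaves a polynomial identity modulo \<open>s2\<close>;
        the \<open>?\<close> allows for goals that are closed without that relation.\<close>
      unfolding metric_defs levi_civita_defs using nz
      by (simp add: field_simps power2_eq_square) (use s2 in algebra)?
    show "t * n = - (p + r + t)"
      unfolding metric_defs levi_civita_defs using nz
      by (simp add: field_simps power2_eq_square) (use s2 in algebra)?
    show "p * k + q * j = 2 * q"
      unfolding metric_defs levi_civita_defs using nz
      by (simp add: field_simps power2_eq_square) (use s2 in algebra)?
    show "q * k + r * j = p + r + t"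
      unfolding metric_defs levi_civita_defs using nz
      by (simp add: field_simps power2_eq_square) (use s2 in algebra)?
    show "p * b - q * k = r - p - t"
      unfolding metric_defs levi_civita_defs using nz
      by (simp add: field_simps power2_eq_square) (use s2 in algebra)?
    show "q * b - r * k = 0"
      unfolding metric_defs levi_civita_defs using nz
      by (simp add: field_simps power2_eq_square) (use s2 in algebra)?
  qed
  interpret sl2_block_metric X m p q r t k j b l n
  proof
    have "m (X i) (X j) = gram_matrix m X $ i $ j" for i j
      by (simp add: gram_matrix_def)
    note m_X = this[unfolded assms(6)]
    show "m (X 1) (X 1) = p" "m (X 1) (X 2) = 0" "m (X 1) (X 3) = q"
      "m (X 2) (X 2) = t" "m (X 2) (X 3) = 0" "m (X 3) (X 3) = r"
      unfolding metric_defs using nz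
      by (simp_all add: m_X vector_3 flip: s_def) (simp_all add: power2_eq_square)
  qed (use assms koszul in simp_all)

  \<comment> \<open>Ricci tensor and Ricci operator of the given metric\<close>
  define K where "K = a\<^sup>2 - 2 * \<alpha>"
  have K_pos: "K > 0"
    unfolding K_def using \<open>\<alpha> < 0\<close> zero_le_power2[of a] by linarith
  define p' where "p' = 2 * (2 * \<alpha> - a^2) / \<alpha>"
  define q' where "q' = 2 * (a^4 - 4 * \<alpha>^2) * \<beta> / (a^2 * \<alpha> * s)"
  define r' where "r' = - (2 * (a^2 - 2 * \<alpha>) * (a^2 * (\<beta>^2 - \<alpha>^2) + 4 * \<alpha> * \<beta>^2)
                   / (a^2 * \<alpha> * (\<alpha>^2 + \<beta>^2)))"
  define t' where "t' = - (2 * (a^4 + 4 * \<beta>^2) / (\<alpha>^2 + \<beta>^2))"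
  note ricci_defs = p'_def q'_def r'_def t'_def
  have ric_eqs: "4 * n + 8 - 2 * k * l - 2 * j * n - 4 * j = p'"
    "2 * k + 2 * l - b * l - j * l = q'"
    "2 * k * l - 2 * b * n = r'"
    "- (2 * k\<^sup>2 + 2 * b * j + 4 * j) = t'"
  proof -
    show "4 * n + 8 - 2 * k * l - 2 * j * n - 4 * j = p'"
      \<comment> \<open>Folding the sum of squares back into \<open>s\<^sup>2\<close> leaves only
        monomial denominators, nonzero by \<open>nz\<close>.\<close>
      unfolding levi_civita_defs ricci_defs s2[symmetric] using nz
      by (simp add: field_simps power2_eq_square power4_eq_xxxx) (use s2 in algebra)?
    show "2 * k + 2 * l - b * l - j * l = q'"
      unfolding levi_civita_defs ricci_defs s2[symmetric] using nz
      by (simp add: field_simps power2_eq_square power4_eq_xxxx) (use s2 in algebra)?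
    show "2 * k * l - 2 * b * n = r'"
      unfolding levi_civita_defs ricci_defs s2[symmetric] using nz
      by (simp add: field_simps power2_eq_square power4_eq_xxxx) (use s2 in algebra)?
    show "- (2 * k\<^sup>2 + 2 * b * j + 4 * j) = t'"
      unfolding levi_civita_defs ricci_defs s2[symmetric] using nz
      by (simp add: field_simps power2_eq_square power4_eq_xxxx) (use s2 in algebra)?
  qed
  have ric: "ricci sl2_bracket m (lincomb x y z) (lincomb x' y' z') =
      p' * (x * x') + q' * (x * z' + z * x') + r' * (z * z') + t' * (y * y')" for x y z x' y' z'
    unfolding ricci_lincomb ric_eqs[symmetric] by (simp add: algebra_simps)

  \<comment> \<open>The solution of the linear system \<open>Ric_eqs\<close>, that is, the inverse
    metric matrix times the Ricci matrix.\<close>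
  define A B C E where "A = K * (a\<^sup>2 * \<alpha> + 2 * \<beta>\<^sup>2) / (2 * \<alpha>)" and "B = - K * \<beta> * s / \<alpha>"
    and "C = K * \<beta> * s / \<alpha>" and "E = K * (a\<^sup>2 * \<alpha> - 2 * \<beta>\<^sup>2) / (2 * \<alpha>)"
  define N where "N = - (a^4 + 4 * \<beta>\<^sup>2) / 2"
  note Ric_defs = A_def B_def C_def E_def N_def
  have Ric_eqs: "p * A + q * C = p'"
    "q * A + r * C = q'"
    "p * B + q * E = q'"
    "q * B + r * E = r'"
    "t * N = t'"
  proof -
    show "p * A + q * C = p'"
      unfolding metric_defs ricci_defs Ric_defs K_def s2[symmetric] using nz
      by (simp add: field_simps power2_eq_square power4_eq_xxxx) (use s2 in algebra)?
    show "q * A + r * C = q'"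
      unfolding metric_defs ricci_defs Ric_defs K_def s2[symmetric] using nz
      by (simp add: field_simps power2_eq_square power4_eq_xxxx) (use s2 in algebra)?
    show "p * B + q * E = q'"
      unfolding metric_defs ricci_defs Ric_defs K_def s2[symmetric] using nz
      by (simp add: field_simps power2_eq_square power4_eq_xxxx) (use s2 in algebra)?
    show "q * B + r * E = r'"
      unfolding metric_defs ricci_defs Ric_defs K_def s2[symmetric] using nz
      by (simp add: field_simps power2_eq_square power4_eq_xxxx) (use s2 in algebra)?
    show "t * N = t'"
      unfolding metric_defs ricci_defs Ric_defs K_def s2[symmetric] using nz
      by (simp add: field_simps power2_eq_square power4_eq_xxxx) (use s2 in algebra)?
  qed
  have Ric: "ricci_operator sl2_bracket m (lincomb x y z) =
      lincomb (A * x + B * z) (N * y) (C * x + E * z)" for x y z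
    using ric Ric_eqs by (rule ricci_operator_lincomb)
  \<comment> \<open>Self-adjointness of the Ricci operator comes from the symmetry of the Ricci
    tensor, visible in its coordinates, and that of \<open>m\<close>.\<close>
  have "m (ricci_operator sl2_bracket m u) v = ricci sl2_bracket m u v" for u v
    using ric Ric_eqs by (rule metric_ricci_operator)
  moreover have "ricci sl2_bracket m u v = ricci sl2_bracket m v u" for u v
    by (rule lincomb_cases[of u], rule lincomb_cases[of v]) (simp add: ric mult.commute)
  moreover have "m u v = m v u" for u v
    using metric by (simp add: pseudo_metric_def symmetric_form_def)
  ultimately have sym_Ric:
    "m (ricci_operator sl2_bracket m u) v = m u (ricci_operator sl2_bracket m v)" for u v
    by metis
  have det: "A * E - B * C = K\<^sup>2 * (a^4 / 4 + \<beta>\<^sup>2)"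
    unfolding Ric_defs using nz
    by (simp add: field_simps power2_eq_square power4_eq_xxxx) (use s2 in algebra)?
  \<comment> \<open>Minus a square: the metric is indefinite on the block, and Lorentzian since
    \<open>p\<close> and \<open>t\<close> are positive.\<close>
  have "p * r - q\<^sup>2 = - (4 / (a\<^sup>2 * s))\<^sup>2"
    unfolding metric_defs using nz
    by (simp add: field_simps power2_eq_square) (use s2 in algebra)?
  then have det_m: "p * r - q\<^sup>2 < 0"
    using nz by simp

  \<comment> \<open>Gram matrix, scalar curvature, signatures and eigenvalues\<close>
  have gram: "gram_matrix (ricci sl2_bracket m) X =
    vector [vector [p', 0, q'], vector [0, t', 0], vector [q', 0, r']]"
    by (simp add: gram_matrix_def vec_eq_iff forall_3 vector_3 X_lincomb ric)
  have linear_Ric: "linear (ricci_operator sl2_bracket m)"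
    by (rule linear_lincombI[where ?f1.0 = "lincomb A 0 C" and ?f2.0 = "lincomb 0 N 0"
          and ?f3.0 = "lincomb B 0 E"])
      (simp add: Ric lincomb_arith algebra_simps)
  have "scalar_curvature sl2_bracket m = A + N + E"
    unfolding scalar_curvature_def
    by (rule endo_trace_lincomb[OF linear_Ric]) (simp_all add: X_lincomb Ric)
  also have "\<dots> = 1/2 * a^4 - 2 * a^2 * \<alpha> - 2 * \<beta>^2"
    unfolding Ric_defs K_def using nz
    by (simp add: field_simps power2_eq_square power4_eq_xxxx)
  finally have scal: "scalar_curvature sl2_bracket m = 1/2 * a^4 - 2 * a^2 * \<alpha> - 2 * \<beta>^2" .
  have sig_ric: "has_signature (ricci sl2_bracket m) 1 2 0"
  proof (rule has_signature_block(2)[OF ric])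
    show "p' > 0"
      unfolding p'_def using K_pos \<open>\<alpha> < 0\<close> by (simp add: K_def divide_neg_neg)
    \<comment> \<open>\<open>Ric_eqs\<close> factors the Ricci block as metric block times operator
      block, so determinants multiply.\<close>
    have "p' * r' - q'\<^sup>2 = (p * A + q * C) * (q * B + r * E) - (q * A + r * C) * (p * B + q * E)"
      unfolding Ric_eqs power2_eq_square ..
    also have "\<dots> = (p * r - q\<^sup>2) * (A * E - B * C)"
      by (simp add: algebra_simps power2_eq_square)
    finally show "p' * r' - q'\<^sup>2 < 0"
      unfolding det using det_m K_pos \<open>\<beta> > 0\<close> by (simp add: mult_neg_pos add_nonneg_pos)
    show "t' < 0"
      unfolding t'_def using \<open>\<beta> > 0\<close> by (simp add: add_nonneg_pos)
  qed
  have sig_m: "has_signature m 2 1 0"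
  proof (rule has_signature_block(1)[OF m_lincomb _ det_m])
    show "p > 0"
      unfolding p_def using nz(1) \<open>\<alpha> < 0\<close> by (simp add: divide_neg_neg mult_pos_neg)
    show "t > 0"
      unfolding t_def using s_pos by simp
  qed
  \<comment> \<open>The real part is half the trace \<open>K * a\<^sup>2\<close> of the block, and
    the imaginary part makes the squared modulus equal to \<open>det\<close>.\<close>
  define w where "w = Complex (K * a\<^sup>2 / 2) (K * \<beta>)"
  have "complex_eigenvalues (ricci_operator sl2_bracket m) = {of_real N, w, cnj w}"
  proof (rule complex_eigenvalues_block[OF Ric])
    show "B \<noteq> 0"
      unfolding B_def using K_pos \<open>\<beta> > 0\<close> nz by simp
    show "of_real (A + E) = w + cnj w"
      using nz by (simp add: A_def E_def w_def complex_eq_iff field_simps)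
    show "of_real (A * E - B * C) = w * cnj w"
      unfolding det by (simp add: w_def complex_eq_iff algebra_simps power2_eq_square power4_eq_xxxx)
  qed
  moreover have "w \<notin> \<real>"
    unfolding w_def using K_pos \<open>\<beta> > 0\<close> by (simp add: complex_is_Real_iff)
  ultimately have "type_azz m (ricci_operator sl2_bracket m)"
    unfolding type_azz_def using sig_m linear_Ric sym_Ric by blast
  then show ?thesis
    using gram scal sig_ric unfolding ricci_defs s_def by simp
qed

end
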